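(* Let $p$ be a prime and $k$ a positive integer, and put $q=kp-1$, $L=pq=kp^2-p$. Let $$\tilde M=\Big\lfloor \frac{k(p+1)}{2(k+1)}\Big\rfloor ,$$ and assign to $\tilde M$ users any $\tilde M$ distinct sequences from the $p$ CRT sequences $s_0(t),\ldots,s_{p-1}(t)$ with parameters $p$ and $q$. Then, for all choices of the users' delay offsets, the system throughput is at least $$\frac14\cdot\frac{(p+1)^2}{kp^2-p}\cdot\frac{k^2}{k+1}-\frac{k+1}{kp^2-p}.$$
   Context: CRT sequences: for $p$ prime and $q$ a positive integer not divisible by $p$, and $g\in\{0,\ldots,p-1\}$, let $\mathcal{I}_{g}=\{(gt \bmod p,\ t): 0\le t<q\}\subset\mathbb{Z}_p\oplus\mathbb{Z}_q$; the CRT sequence generated by $g$ is the binary sequence $s_g(t)$, $t\in\mathbb{Z}_{pq}$, with $s_g(t)=1$ if $(t\bmod p,\ t\bmod q)\in\mathcal{I}_g$ and $0$ otherwise; it is extended periodically with period $L=pq$. Collision channel without feedback (all users permanently active): time is slotted; user $i$ is assigned a periodic binary sequence $a_i(t)$ of period $L$ and has an arbitrary fixed delay offset $\tau_i$; it transmits a packet in slot $t$ iff $a_i(t+\tau_i)=1$. A packet sent in a slot is received successfully iff exactly one user transmits in that slot. The system throughput is the number of slots in one period of $L$ slots in which exactly one user transmits (i.e. the total number of successful packets over all users), divided by $L$. *)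

theory Defs
  imports Complex_Main "HOL-Computational_Algebra.Primes"
begin

definition crt_char_set :: "nat \<Rightarrow> nat \<Rightarrow> nat \<Rightarrow> (int \<times> int) set" where
  "crt_char_set p q g = {((int g * t) mod int p, t) | t. 0 \<le> t \<and> t < int q}"

text \<open>Time ranges over all of the integers: the value depends on \<open>t\<close> only through its residues
  modulo \<open>p\<close> and \<open>q\<close>, so this is already the extension with period \<open>p * q\<close>.\<close>

definition crt_seq :: "nat \<Rightarrow> nat \<Rightarrow> nat \<Rightarrow> int \<Rightarrow> nat" where
  "crt_seq p q g t = (if (t mod int p, t mod int q) \<in> crt_char_set p q g then 1 else 0)"

definition transmits :: "('u \<Rightarrow> int \<Rightarrow> nat) \<Rightarrow> ('u \<Rightarrow> int) \<Rightarrow> 'u \<Rightarrow> int \<Rightarrow> bool" where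
  "transmits a \<tau> i t \<longleftrightarrow> a i (t + \<tau> i) = 1"

definition system_throughput ::
    "nat \<Rightarrow> 'u set \<Rightarrow> ('u \<Rightarrow> int \<Rightarrow> nat) \<Rightarrow> ('u \<Rightarrow> int) \<Rightarrow> real" where
  "system_throughput L U a \<tau> =
     real (card {t \<in> {0..<int L}. \<exists>!i. i \<in> U \<and> transmits a \<tau> i t}) / real L"

end

theory Submission
  imports Defs "HOL-Number_Theory.Cong"
begin

text \<open>
  By the Chinese remainder theorem a slot \<open>t\<close> is a pair \<open>(t mod p, t mod q)\<close>, and the slots used by a
  shifted CRT sequence form the graph of a function \<open>y = t mod q \<mapsto> t mod p\<close> that is affine
  modulo \<open>p\<close> except for one jump where \<open>y\<close> wraps around. Thus every user transmits \<open>q\<close> times per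
  period, and two users with distinct generators collide only for \<open>y\<close> in one residue class
  modulo \<open>p\<close> on each of two intervals of total length \<open>q = k p - 1\<close>, hence at most \<open>k + 1\<close> times.
  So at least \<open>M (q - (M - 1) (k + 1)) = M (k (p + 1) - M (k + 1))\<close> slots are successful. This quadratic in
  \<open>M\<close> is maximal at \<open>x = k (p + 1) / (2 (k + 1))\<close>, and replacing \<open>x\<close> by \<open>\<lfloor>x\<rfloor>\<close> costs at most \<open>k + 1\<close>.
\<close>

lemma crt_seq_eq_1_iff:
  assumes "q > 0"
  shows "crt_seq p q g t = 1 \<longleftrightarrow> [t = int g * (t mod int q)] (mod int p)"
  using assms by (auto simp: crt_seq_def crt_char_set_def cong_def)

lemma crt_seq_periodic:
  assumes "int p * int q dvd t - u"
  shows "crt_seq p q g t = crt_seq p q g u"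
proof -
  have "t mod int p = u mod int p" "t mod int q = u mod int q"
    using assms by (meson dvd_mult_left dvd_mult_right mod_eq_dvd_iff)+
  then show ?thesis by (simp add: crt_seq_def)
qed

text \<open>Translation by \<open>c\<close> permutes the residues modulo \<open>L\<close>, so a
  common delay does not affect a count over one period. This reduces absolute delays to relative
  ones.\<close>

lemma card_shift_periodic:
  fixes L c :: int
  assumes "L > 0" and periodic: "\<And>t u. L dvd t - u \<Longrightarrow> P t = P u"
  shows "card {t \<in> {0..<L}. P (t + c)} = card {t \<in> {0..<L}. P t}"
proof (rule bij_betw_same_card[of "\<lambda>t. (t + c) mod L"], rule bij_betw_byWitness[where f' = "\<lambda>t. (t - c) mod L"])
  have P_mod: "P (t mod L) = P t" for t
    by (rule periodic) (simp add: mod_eq_dvd_iff[symmetric])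
  have P_mod': "P ((t - c) mod L + c) = P t" for t
    by (rule periodic) (simp add: mod_eq_dvd_iff[symmetric] mod_simps)
  show "\<forall>t\<in>{t \<in> {0..<L}. P (t + c)}. ((t + c) mod L - c) mod L = t"
    "\<forall>t\<in>{t \<in> {0..<L}. P t}. ((t - c) mod L + c) mod L = t"
    by (auto simp: mod_simps)
  show "(\<lambda>t. (t + c) mod L) ` {t \<in> {0..<L}. P (t + c)} \<subseteq> {t \<in> {0..<L}. P t}"
    using \<open>L > 0\<close> by (auto simp: P_mod)
  show "(\<lambda>t. (t - c) mod L) ` {t \<in> {0..<L}. P t} \<subseteq> {t \<in> {0..<L}. P (t + c)}"
    using \<open>L > 0\<close> by (auto simp: P_mod')
qed

text \<open>Every residue \<open>y\<close> modulo \<open>q\<close> is hit: the Chinese remainder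
  theorem supplies a slot congruent to \<open>y\<close> modulo \<open>q\<close> and to
  \<open>g * y\<close> modulo \<open>p\<close>.\<close>

lemma crt_seq_weight:
  assumes "q > 0" "p > 0" "coprime p q"
  shows "card {t \<in> {0..<int (p * q)}. crt_seq p q g t = 1} \<ge> q"
proof -
  let ?T = "{t \<in> {0..<int (p * q)}. crt_seq p q g t = 1}"
  have "{0..<int q} \<subseteq> (\<lambda>t. t mod int q) ` ?T"
  proof
    fix y assume y: "y \<in> {0..<int q}"
    obtain x where x: "[x = int g * y] (mod int p)" "[x = y] (mod int q)"
      using binary_chinese_remainder_int[of "int p" "int q" "int g * y" y] assms by auto
    define t where "t = x mod int (p * q)"
    have t: "[t = x] (mod int p)" "[t = x] (mod int q)"
      by (simp_all add: t_def cong_def mod_mod_cancel)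
    have "t mod int q = y"
      using cong_trans[OF t(2) x(2)] y by (simp add: cong_def)
    moreover from this have "crt_seq p q g t = 1"
      using cong_trans[OF t(1) x(1)] crt_seq_eq_1_iff[OF \<open>q > 0\<close>, of p g t] by simp
    moreover have "t \<in> {0..<int (p * q)}"
      using assms by (simp add: t_def)
    ultimately show "y \<in> (\<lambda>t. t mod int q) ` ?T" by force
  qed
  then have "card {0..<int q} \<le> card ((\<lambda>t. t mod int q) ` ?T)"
    by (intro card_mono finite_imageI finite_Collect_conjI) auto
  also have "\<dots> \<le> card ?T"
    by (intro card_image_le finite_Collect_conjI) auto
  finally show ?thesis by simp
qed

text \<open>The bound is the ceiling of \<open>w / p\<close>, the number of blocks of length
  \<open>p\<close> needed to cover the window; each block holds at most one member of a residue
  class.\<close>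

lemma card_residue_class_le:
  fixes b :: int
  assumes "p > 0" "S \<subseteq> {b..<b + int w}"
    and "\<And>x y. x \<in> S \<Longrightarrow> y \<in> S \<Longrightarrow> [x = y] (mod int p)"
  shows "card S \<le> (w + p - 1) div p"
proof -
  let ?f = "\<lambda>y. (y - b) div int p"
  have "inj_on ?f S"
  proof (rule inj_onI)
    fix x y assume xy: "x \<in> S" "y \<in> S" "?f x = ?f y"
    have "(x - b) mod int p = (y - b) mod int p"
      using assms(3)[OF xy(1,2)] by (metis cong_def mod_diff_left_eq)
    then have "x - b = y - b"
      using xy(3) by (metis div_mult_mod_eq)
    then show "x = y" by simp
  qed
  moreover have "?f ` S \<subseteq> {0..<int ((w + p - 1) div p)}"
  proof safe
    fix y assume "y \<in> S"
    then have y: "0 \<le> y - b" "y - b \<le> int w - 1"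
      using assms(2) by auto
    show "?f y \<in> {0..<int ((w + p - 1) div p)}"
    proof -
      have "?f y \<le> (int w - 1) div int p"
        using y assms(1) by (intro zdiv_mono1) auto
      also have "\<dots> < (int w - 1 + int p) div int p"
        using assms(1) by simp
      also have "\<dots> = int ((w + p - 1) div p)"
        using assms(1) by (simp add: zdiv_int of_nat_diff algebra_simps)
      finally show ?thesis
        using y assms(1) by (simp add: pos_imp_zdiv_nonneg_iff)
    qed
  qed
  ultimately have "card S \<le> card {0..<int ((w + p - 1) div p)}"
    by (intro card_inj_on_le) auto
  then show ?thesis by simp
qed

text \<open>Here \<open>c\<close> is the relative delay. The bound merges two ceilings, one for each
  side of the wrap-around, whose window lengths add up to \<open>q\<close>.\<close>

lemma crt_seq_cross_correlation:
  assumes "prime p" "q > 0" "coprime p q" "g < p" "h < p" "g \<noteq> h"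
  shows "card {t \<in> {0..<int (p * q)}. crt_seq p q g t = 1 \<and> crt_seq p q h (t + c) = 1}
    \<le> (q + 2 * p - 2) div p"
proof -
  let ?T = "{t \<in> {0..<int (p * q)}. crt_seq p q g t = 1 \<and> crt_seq p q h (t + c) = 1}"
  have "p > 0" using \<open>prime p\<close> by (simp add: prime_gt_0_nat)
  \<comment> \<open>The residues \<open>y\<close> in \<open>{0..<int q}\<close> with
    \<open>y < int w\<close> are those for which \<open>y + c mod int q\<close> stays below
    \<open>q\<close>; the others wrap around once.\<close>
  define w where "w = nat (int q - c mod int q)"
  have w: "int w = int q - c mod int q" "w \<le> q" "c mod int q = int q - int w" "w > 0"
    using pos_mod_bound[of "int q" c] pos_mod_sign[of "int q" c] \<open>q > 0\<close> unfolding w_def by linarith+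
  \<comment> \<open>The collision condition on a window of length \<open>e\<close> starting at
    \<open>b\<close>, where the second sequence sees the residue \<open>y + d\<close>:
    \<open>d\<close> is \<open>c mod int q\<close> before the wrap and
    \<open>c mod int q - int q\<close> after it.\<close>
  define A where "A d b e = {y \<in> {b..<b + int e}. [int g * y + c = int h * (y + d)] (mod int p)}"
    for d b :: int and e :: nat
  have fin_A: "finite (A d b e)" for d b e
    unfolding A_def by (rule finite_subset[of _ "{b..<b + int e}"]) auto
  have card_A: "card (A d b e) \<le> (e + p - 1) div p" for d b e
  proof (rule card_residue_class_le)
    fix x y assume "x \<in> A d b e" "y \<in> A d b e"
    \<comment> \<open>Subtracting the two congruences cancels \<open>c\<close> and \<open>d\<close>,
      so only the difference of the slopes \<open>g\<close> and \<open>h\<close> matters.\<close>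
    then have "int p dvd (int g * x + c - int h * (x + d)) - (int g * y + c - int h * (y + d))"
      unfolding A_def by (intro dvd_diff[of _ "int g * x + c - int h * (x + d)"])
        (simp_all add: cong_iff_dvd_diff)
    also have "\<dots> = (int g - int h) * (x - y)"
      by (simp add: algebra_simps)
    finally have "int p dvd (int g - int h) * (x - y)" .
    moreover have "\<not> int p dvd int g - int h"
      using assms(4-6) zdvd_imp_le[of "int p" "int g - int h"] zdvd_imp_le[of "int p" "int h - int g"]
      by (cases "g < h") (auto simp: dvd_diff_commute)
    ultimately have "int p dvd x - y"
      using \<open>prime p\<close> by (simp add: prime_dvd_mult_iff)
    then show "[x = y] (mod int p)" by (simp add: cong_iff_dvd_diff)
  qed (use \<open>p > 0\<close> in \<open>auto simp: A_def\<close>)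
  \<comment> \<open>The residue modulo \<open>q\<close> determines the slot, because
    \<open>g\<close> times it gives the residue modulo \<open>p\<close>. Counting residues
    \<open>y\<close> therefore suffices.\<close>
  have "inj_on (\<lambda>t. t mod int q) ?T"
  proof (rule inj_onI)
    fix t u assume t: "t \<in> ?T" and u: "u \<in> ?T" and tu: "t mod int q = u mod int q"
    have "[t = u] (mod int p)"
      using t u tu crt_seq_eq_1_iff[OF \<open>q > 0\<close>, of p g] by (auto intro: cong_trans cong_sym)
    moreover have "[t = u] (mod int q)"
      using tu by (simp add: cong_def)
    ultimately have "[t = u] (mod int p * int q)"
      using \<open>coprime p q\<close> by (simp add: coprime_cong_mult)
    then show "t = u"
      using t u by (simp add: cong_def)
  qed
  moreover have "(\<lambda>t. t mod int q) ` ?T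
      \<subseteq> A (c mod int q) 0 w \<union> A (c mod int q - int q) (int w) (q - w)"
  proof safe
    fix t assume "crt_seq p q g t = 1" and "crt_seq p q h (t + c) = 1"
      and notin: "t mod int q \<notin> A (c mod int q - int q) (int w) (q - w)"
    define y where "y = t mod int q"
    have y: "0 \<le> y" "y < int q"
      using \<open>q > 0\<close> by (auto simp: y_def)
    have t1: "[t = int g * y] (mod int p)"
      and t2: "[t + c = int h * ((t + c) mod int q)] (mod int p)"
      using \<open>crt_seq p q g t = 1\<close> \<open>crt_seq p q h (t + c) = 1\<close>
      unfolding crt_seq_eq_1_iff[OF \<open>q > 0\<close>] y_def by simp_all
    have key: "[int g * y + c = int h * ((t + c) mod int q)] (mod int p)"
      using cong_trans[OF cong_add[OF cong_sym[OF t1] cong_refl] t2] .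
    have tc: "(t + c) mod int q = (y + c mod int q) mod int q"
      by (simp add: y_def mod_simps)
    have "y < int w"
    proof (rule ccontr)
      assume "\<not> y < int w"
      have "(t + c) mod int q = (y + c mod int q - int q) mod int q"
        by (simp add: tc)
      also have "\<dots> = y + c mod int q - int q"
        using y(2) w(3,4) \<open>\<not> y < int w\<close> by (intro mod_pos_pos_trivial) linarith+
      finally have "[int g * y + c = int h * (y + (c mod int q - int q))] (mod int p)"
        using key by (simp only: add_diff_eq)
      then have "y \<in> A (c mod int q - int q) (int w) (q - w)"
        using \<open>\<not> y < int w\<close> y(2) w(2) unfolding A_def mem_Collect_eq atLeastLessThan_iff
        by (intro conjI) linarith+
      with notin show False
        unfolding y_def by contradiction
    qed
    then have "(t + c) mod int q = y + c mod int q"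
      using y(1) w(3) pos_mod_sign[of "int q" c] \<open>q > 0\<close>
      unfolding tc by (intro mod_pos_pos_trivial) linarith+
    then have "y \<in> A (c mod int q) 0 w"
      using key \<open>y < int w\<close> y(1) unfolding A_def mem_Collect_eq atLeastLessThan_iff by simp
    then show "t mod int q \<in> A (c mod int q) 0 w"
      unfolding y_def .
  qed
  ultimately have "card ?T \<le> card (A (c mod int q) 0 w \<union> A (c mod int q - int q) (int w) (q - w))"
    by (intro card_inj_on_le finite_UnI fin_A)
  also have "\<dots> \<le> (w + p - 1) div p + (q - w + p - 1) div p"
    by (rule order_trans[OF card_Un_le add_mono[OF card_A card_A]])
  \<comment> \<open>Superadditivity of the floor: adding the numerators can only gain from the
    remainders.\<close>
  also have "\<dots> \<le> (w + p - 1 + (q - w + p - 1)) div p"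
    by (subst div_add1_eq) simp
  also have "w + p - 1 + (q - w + p - 1) = q + 2 * p - 2"
    using w(2) \<open>p > 0\<close> by linarith
  finally show ?thesis .
qed

text \<open>Removing from each \<open>T i\<close> its overlaps with the other sets costs at most
  \<open>c\<close> per other index. What remains is pairwise disjoint and covered exactly once.
  Working over the integers allows the lower bound to be negative.\<close>

lemma card_unique_cover_ge:
  fixes T :: "'u \<Rightarrow> 's set" and m c :: int
  assumes "finite X" "finite U"
    and sub: "\<And>i. i \<in> U \<Longrightarrow> T i \<subseteq> X"
    and weight: "\<And>i. i \<in> U \<Longrightarrow> m \<le> int (card (T i))"
    and corr: "\<And>i j. i \<in> U \<Longrightarrow> j \<in> U \<Longrightarrow> i \<noteq> j \<Longrightarrow> int (card (T i \<inter> T j)) \<le> c"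
  shows "int (card U) * (m - (int (card U) - 1) * c) \<le> int (card {t \<in> X. \<exists>!i. i \<in> U \<and> t \<in> T i})"
proof -
  define S where "S i = T i - (\<Union>j\<in>U - {i}. T i \<inter> T j)" for i
  have fin: "finite (T i)" if "i \<in> U" for i
    using sub[OF that] \<open>finite X\<close> finite_subset by blast
  have card_S: "m - (int (card U) - 1) * c \<le> int (card (S i))" if "i \<in> U" for i
  proof -
    have "int (card (\<Union>j\<in>U - {i}. T i \<inter> T j)) \<le> (\<Sum>j\<in>U - {i}. int (card (T i \<inter> T j)))"
      using card_UN_le[of "U - {i}" "\<lambda>j. T i \<inter> T j"] \<open>finite U\<close> by (simp flip: of_nat_sum)
    also have "\<dots> \<le> (\<Sum>j\<in>U - {i}. c)"
      using corr that by (intro sum_mono) auto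
    also have "\<dots> = (int (card U) - 1) * c"
      using card.remove[OF \<open>finite U\<close> that] by (simp only: sum_constant) simp
    finally have "int (card (\<Union>j\<in>U - {i}. T i \<inter> T j)) \<le> (int (card U) - 1) * c" .
    moreover have "card (T i) - card (\<Union>j\<in>U - {i}. T i \<inter> T j) \<le> card (S i)"
      unfolding S_def by (rule diff_card_le_card_Diff) (use \<open>finite U\<close> fin that in auto)
    ultimately show ?thesis
      using weight[OF that] by linarith
  qed
  have "int (card U) * (m - (int (card U) - 1) * c) = (\<Sum>i\<in>U. m - (int (card U) - 1) * c)"
    by simp
  also have "\<dots> \<le> (\<Sum>i\<in>U. int (card (S i)))"
    by (intro sum_mono card_S)
  also have "\<dots> = int (card (\<Union>i\<in>U. S i))"
    using \<open>finite U\<close> fin by (subst card_UN_disjoint) (auto simp: S_def)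
  also have "card (\<Union>i\<in>U. S i) \<le> card {t \<in> X. \<exists>!i. i \<in> U \<and> t \<in> T i}"
  proof (rule card_mono)
    show "(\<Union>i\<in>U. S i) \<subseteq> {t \<in> X. \<exists>!i. i \<in> U \<and> t \<in> T i}"
      unfolding S_def using sub by blast
  qed (use \<open>finite X\<close> in simp)
  finally show ?thesis by simp
qed

theorem theorem7:
  fixes p k q L M :: nat
    and a :: "nat \<Rightarrow> int \<Rightarrow> nat"
    and \<tau> :: "nat \<Rightarrow> int"
  assumes "prime p"
    and "k > 0"
    and "q = k * p - 1"
    and "L = p * q"
    and "M = nat \<lfloor>real k * (real p + 1) / (2 * (real k + 1))\<rfloor>"
    and "\<And>i. i < M \<Longrightarrow> a i \<in> crt_seq p q ` {..<p}"
    and "inj_on a {..<M}"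
  shows "system_throughput L {..<M} a \<tau> \<ge>
    1 / 4 * ((real p + 1)\<^sup>2 / (real k * (real p)\<^sup>2 - real p)) * ((real k)\<^sup>2 / (real k + 1))
      - (real k + 1) / (real k * (real p)\<^sup>2 - real p)"
proof -
  have "p \<ge> 2" using \<open>prime p\<close> by (rule prime_ge_2_nat)
  moreover have "p \<le> k * p" using \<open>k > 0\<close> by simp
  ultimately have "q > 0" and kp: "k * p = q + 1"
    using assms(3) by linarith+
  \<comment> \<open>The consecutive numbers \<open>q\<close> and \<open>k * p\<close> are coprime,
    and \<open>p\<close> divides the latter.\<close>
  have "coprime p q"
    by (metis kp coprime_Suc_left_nat coprime_commute coprime_mult_left_iff Suc_eq_plus1)
  have "L > 0" using assms(4) \<open>q > 0\<close> \<open>p \<ge> 2\<close> by simp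
  \<comment> \<open>Since \<open>q = k * p - 1\<close>, the numerator equals
    \<open>(k + 2) * p - 3\<close>, just short of the next multiple of \<open>p\<close>.\<close>
  have corr_bound: "(q + 2 * p - 2) div p \<le> k + 1"
  proof -
    have "q + 2 * p - 2 < (k + 2) * p"
      using kp \<open>p \<ge> 2\<close> by (simp add: algebra_simps)
    then have "(q + 2 * p - 2) div p < k + 2"
      using \<open>p \<ge> 2\<close> by (simp add: div_less_iff_less_mult)
    then show ?thesis by simp
  qed

  define T where "T i = {t \<in> {0..<int L}. a i (t + \<tau> i) = 1}" for i
  have weight: "int q \<le> int (card (T i))" if "i \<in> {..<M}" for i
  proof -
    obtain g where "a i = crt_seq p q g" using assms(6) \<open>i \<in> {..<M}\<close> by auto
    moreover have "card {t \<in> {0..<int L}. crt_seq p q g (t + \<tau> i) = 1}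
        = card {t \<in> {0..<int L}. crt_seq p q g t = 1}"
    proof (rule card_shift_periodic)
      show "(crt_seq p q g t = 1) = (crt_seq p q g u = 1)" if "int L dvd t - u" for t u
        using crt_seq_periodic[of p q t u g] that assms(4) by simp
    qed (use \<open>L > 0\<close> in simp)
    ultimately have "card (T i) = card {t \<in> {0..<int L}. crt_seq p q g t = 1}"
      by (simp add: T_def)
    then show ?thesis
      using crt_seq_weight[OF \<open>q > 0\<close> _ \<open>coprime p q\<close>] \<open>p \<ge> 2\<close> assms(4) by simp
  qed
  have corr: "int (card (T i \<inter> T j)) \<le> int k + 1" if "i \<in> {..<M}" "j \<in> {..<M}" "i \<noteq> j" for i j
  proof -
    obtain g where g: "a i = crt_seq p q g" "g < p"
      using assms(6) \<open>i \<in> {..<M}\<close> by auto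
    obtain h where h: "a j = crt_seq p q h" "h < p"
      using assms(6) \<open>j \<in> {..<M}\<close> by auto
    have "a i \<noteq> a j"
      using inj_onD[OF assms(7)] that by blast
    then have "g \<noteq> h" using g h by auto
    \<comment> \<open>Time is measured on the clock of user \<open>i\<close>, so that only the
      relative delay \<open>\<tau> j - \<tau> i\<close> enters.\<close>
    let ?P = "\<lambda>t. crt_seq p q g t = 1 \<and> crt_seq p q h (t + (\<tau> j - \<tau> i)) = 1"
    have "?P t = ?P u" if "int L dvd t - u" for t u
      using that assms(4) crt_seq_periodic[of p q t u g]
        crt_seq_periodic[of p q "t + (\<tau> j - \<tau> i)" "u + (\<tau> j - \<tau> i)" h] by simp
    then have "card {t \<in> {0..<int L}. ?P (t + \<tau> i)} = card {t \<in> {0..<int L}. ?P t}"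
      using \<open>L > 0\<close> by (intro card_shift_periodic) auto
    moreover have "T i \<inter> T j = {t \<in> {0..<int L}. ?P (t + \<tau> i)}"
      by (auto simp: T_def g h algebra_simps)
    ultimately have "card (T i \<inter> T j) \<le> k + 1"
      using crt_seq_cross_correlation[OF \<open>prime p\<close> \<open>q > 0\<close> \<open>coprime p q\<close> \<open>g < p\<close> \<open>h < p\<close> \<open>g \<noteq> h\<close>]
        corr_bound assms(4) le_trans by (simp only:) blast
    then show ?thesis by simp
  qed

  have T_sub: "T i \<subseteq> {0..<int L}" if "i \<in> {..<M}" for i
    by (auto simp: T_def)
  let ?N = "card {t \<in> {0..<int L}. \<exists>!i. i \<in> {..<M} \<and> transmits a \<tau> i t}"
  have "{t \<in> {0..<int L}. \<exists>!i. i \<in> {..<M} \<and> t \<in> T i}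
      = {t \<in> {0..<int L}. \<exists>!i. i \<in> {..<M} \<and> transmits a \<tau> i t}"
    by (auto simp: T_def transmits_def)
  then have "int M * (int q - (int M - 1) * (int k + 1)) \<le> int ?N"
    using card_unique_cover_ge[of "{0..<int L}" "{..<M}" T "int q" "int k + 1", OF _ _ T_sub weight corr]
    by simp
  then have "real_of_int (int M * (int q - (int M - 1) * (int k + 1))) \<le> real_of_int (int ?N)"
    by (simp only: of_int_le_iff)
  then have N_ge: "real M * (real q - (real M - 1) * (real k + 1)) \<le> real ?N"
    by simp
  have q_eq: "real q = real k * real p - 1"
    using kp by (metis add_diff_cancel_right' of_nat_1 of_nat_add of_nat_mult)
  have L_eq: "real L = real k * (real p)\<^sup>2 - real p"
    by (simp add: assms(4) q_eq power2_eq_square algebra_simps)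

  define x where "x = real k * (real p + 1) / (2 * (real k + 1))"
  \<comment> \<open>Nonnegativity ensures that \<open>nat\<close> does not truncate the floor of
    \<open>x\<close>, so \<open>M\<close> lies within 1 of \<open>x\<close>.\<close>
  have "x \<ge> 0" by (simp add: x_def)
  then have "\<bar>x - real M\<bar> \<le> 1"
    using assms(5) unfolding x_def[symmetric] by linarith
  then have "(x - real M)\<^sup>2 \<le> 1"
    by (simp add: abs_square_le_1)
  have x: "real k * (real p + 1) = 2 * (real k + 1) * x"
    by (simp add: x_def)
  \<comment> \<open>Completing the square: the quadratic in \<open>M\<close> is its vertex value
    \<open>x\<^sup>2 * (real k + 1)\<close> minus
    \<open>(x - real M)\<^sup>2 * (real k + 1)\<close>, and the latter is at most
    \<open>k + 1\<close>.\<close>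
  have "x\<^sup>2 * (real k + 1) - (real k + 1) \<le> x\<^sup>2 * (real k + 1) - (x - real M)\<^sup>2 * (real k + 1)"
    using mult_right_mono[OF \<open>(x - real M)\<^sup>2 \<le> 1\<close>, of "real k + 1"] by (simp only: mult_1_left) linarith
  also have "\<dots> = real M * (2 * (real k + 1) * x - real M * (real k + 1))"
    by (simp add: power2_eq_square algebra_simps)
  also have "\<dots> = real M * (real q - (real M - 1) * (real k + 1))"
    unfolding x[symmetric] q_eq by (simp add: algebra_simps)
  also note N_ge
  finally have "(x\<^sup>2 * (real k + 1) - (real k + 1)) / real L \<le> real ?N / real L"
    by (rule divide_right_mono) simp
  \<comment> \<open>The vertex value, divided by \<open>L\<close>, is the main term of the claimed
    bound.\<close>
  moreover have "x\<^sup>2 * (real k + 1) = 1 / 4 * (real p + 1)\<^sup>2 * ((real k)\<^sup>2 / (real k + 1))"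
    by (simp add: x_def power2_eq_square divide_simps) (simp add: algebra_simps)
  ultimately show ?thesis
    unfolding system_throughput_def L_eq[symmetric]
    by (simp add: diff_divide_distrib mult.commute mult.left_commute distrib_left)
qed

end
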